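(* Let $g:(-1,1)\to\mathbb{R}$ be continuous and nondecreasing with inverse $g^{-1}$ (defined on the range of $g$). Let $p\ge 2$ and let $\bm{A}=(A_1,\dots,A_p)^\top$ be a $\{-1,1\}^p$-valued random vector that is non-degenerate, i.e. takes all $2^p$ values with positive probability. For every $\bm{\gamma}\in\mathbb{R}^{2^p}$ such that $\bm{\gamma}^\top\bm{A}^{\otimes}$ is in the range of $g$ (for all values of $\bm{A}$), let $\bm{\beta}_{\bm{\gamma}}\in\mathbb{R}^{2^p}$ be the vector satisfying $\bm{\beta}_{\bm{\gamma}}^\top\bm{A}^{\otimes}=g^{-1}(\bm{\gamma}^\top\bm{A}^{\otimes})$. Let $\gamma_{12}$ and $\beta_{\bm{\gamma},12}$ be the coefficients of $A_1A_2$ in $\bm{\gamma}$ and $\bm{\beta}_{\bm{\gamma}}$, respectively. Suppose that for all such $\bm{\gamma}$, $\gamma_{12}=0$ if and only if $\beta_{\bm{\gamma},12}=0$. Then $g$ is a linear function, i.e. $g(x)=ax+b$ for some constants $a,b\in\mathbb{R}$.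
   Context: For $\bm{A}\in\{-1,1\}^p$, $\bm{A}^{\otimes}=\begin{pmatrix}1\\ A_1\end{pmatrix}\otimes\cdots\otimes\begin{pmatrix}1\\ A_p\end{pmatrix}\in\{-1,1\}^{2^p}$; its coordinates are all products $\prod_{j\in\Lambda}A_j$, $\Lambda\subseteq\{1,\dots,p\}$, and coefficient vectors in $\mathbb{R}^{2^p}$ are indexed by these coordinates. *)

theory Defs
  imports "HOL-Probability.Probability"
begin

definition sign_vectors :: "nat \<Rightarrow> (nat \<Rightarrow> real) set" where
  "sign_vectors p = {1..p} \<rightarrow>\<^sub>E {- 1, 1}"

text \<open>
  Real vectors of dimension \<open>2 ^ p\<close>, with coordinates indexed by the subsets of \<open>{1..p}\<close>
  instead of by their positions in the Kronecker product.  Vectors are extensional, so that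
  equality of functions is equality of vectors.
\<close>

definition coeff_vectors :: "nat \<Rightarrow> (nat set \<Rightarrow> real) set" where
  "coeff_vectors p = Pow {1..p} \<rightarrow>\<^sub>E UNIV"

text \<open>
  The Kronecker product of the vectors \<open>(1, a j)\<close>, \<open>j = 1, \<dots>, p\<close>: its coordinate at
  \<open>L\<close> takes the entry \<open>a j\<close> from the factors with \<open>j \<in> L\<close> and the entry \<open>1\<close> from the others.
\<close>

definition tensor_vec :: "nat \<Rightarrow> (nat \<Rightarrow> real) \<Rightarrow> nat set \<Rightarrow> real" where
  "tensor_vec p a = (\<lambda>L\<in>Pow {1..p}. \<Prod>j\<in>L. a j)"

definition coeff_inner :: "nat \<Rightarrow> (nat set \<Rightarrow> real) \<Rightarrow> (nat set \<Rightarrow> real) \<Rightarrow> real" where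
  "coeff_inner p u v = (\<Sum>L\<in>Pow {1..p}. u L * v L)"

definition admissible ::
    "(real \<Rightarrow> real) \<Rightarrow> nat \<Rightarrow> 'a measure \<Rightarrow> ('a \<Rightarrow> nat \<Rightarrow> real) \<Rightarrow> (nat set \<Rightarrow> real) \<Rightarrow> bool" where
  "admissible g p M A \<gamma> \<longleftrightarrow>
    \<gamma> \<in> coeff_vectors p \<and>
    (\<forall>\<omega>\<in>space M. coeff_inner p \<gamma> (tensor_vec p (A \<omega>)) \<in> g ` {- 1<..<1})"

definition beta_vec ::
    "(real \<Rightarrow> real) \<Rightarrow> nat \<Rightarrow> 'a measure \<Rightarrow> ('a \<Rightarrow> nat \<Rightarrow> real) \<Rightarrow> (nat set \<Rightarrow> real) \<Rightarrow> nat set \<Rightarrow> real" where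
  "beta_vec g p M A \<gamma> =
    (THE \<beta>. \<beta> \<in> coeff_vectors p \<and>
      (\<forall>\<omega>\<in>space M. coeff_inner p \<beta> (tensor_vec p (A \<omega>)) =
        the_inv_into {- 1<..<1} g (coeff_inner p \<gamma> (tensor_vec p (A \<omega>)))))"

definition nondegenerate :: "nat \<Rightarrow> 'a measure \<Rightarrow> ('a \<Rightarrow> nat \<Rightarrow> real) \<Rightarrow> bool" where
  "nondegenerate p M A \<longleftrightarrow>
    (\<forall>a\<in>sign_vectors p. measure M {\<omega> \<in> space M. A \<omega> = a} > 0)"

text \<open>The definite description in \<open>beta_vec\<close> is proper for a non-degenerate vector.\<close>

lemma tensor_vec_eq:
  assumes "L \<subseteq> {1..p}"
  shows "tensor_vec p a L = (\<Prod>j\<in>{1..p}. if j \<in> L then a j else 1)"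
proof -
  have "{1..p} \<inter> L = L" using assms by auto
  then show ?thesis using assms
    by (simp add: tensor_vec_def flip: prod.inter_restrict)
qed

lemma sum_sign_vectors:
  assumes "L \<subseteq> {1..p}" "K \<subseteq> {1..p}"
  shows "(\<Sum>a\<in>sign_vectors p. tensor_vec p a L * tensor_vec p a K) = (if L = K then 2 ^ p else 0)"
proof -
  let ?h = "\<lambda>j s::real. (if j \<in> L then s else 1) * (if j \<in> K then s else 1)"
  have "(\<Sum>a\<in>sign_vectors p. tensor_vec p a L * tensor_vec p a K)
      = (\<Sum>a\<in>sign_vectors p. \<Prod>j\<in>{1..p}. ?h j (a j))"
    using assms by (simp only: tensor_vec_eq prod.distrib)
  also have "\<dots> = (\<Prod>j\<in>{1..p}. \<Sum>s\<in>{- 1, 1}. ?h j s)"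
    unfolding sign_vectors_def by (rule prod_sum_PiE [symmetric]) auto
  also have "\<dots> = (\<Prod>j\<in>{1..p}. if j \<in> L \<longleftrightarrow> j \<in> K then 2 else 0)"
    by (intro prod.cong) auto
  also have "\<dots> = (if L = K then 2 ^ p else 0)"
  proof (cases "L = K")
    case False
    then obtain j where "j \<in> {1..p}" "(j \<in> L) \<noteq> (j \<in> K)" using assms by blast
    then have "(\<Prod>j\<in>{1..p}. if j \<in> L \<longleftrightarrow> j \<in> K then 2 else (0::real)) = 0"
      by (intro prod_zero) auto
    with False show ?thesis by simp
  qed simp
  finally show ?thesis .
qed

lemma sum_coeffs:
  assumes "a \<in> sign_vectors p" "b \<in> sign_vectors p"
  shows "(\<Sum>L\<in>Pow {1..p}. tensor_vec p a L * tensor_vec p b L) = (if a = b then 2 ^ p else 0)"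
proof -
  have "(\<Sum>L\<in>Pow {1..p}. tensor_vec p a L * tensor_vec p b L)
      = (\<Sum>L\<in>Pow {1..p}. (\<Prod>j\<in>L. a j * b j) * (\<Prod>j\<in>{1..p} - L. 1))"
    by (intro sum.cong) (auto simp: tensor_vec_def prod.distrib)
  also have "\<dots> = (\<Prod>j\<in>{1..p}. a j * b j + 1)"
    by (rule prod_add [symmetric]) simp
  also have "\<dots> = (if a = b then 2 ^ p else 0)"
  proof (cases "a = b")
    case True
    have "a j * a j + 1 = 2" if "j \<in> {1..p}" for j
      using PiE_mem [OF assms(1) [unfolded sign_vectors_def] that] by auto
    with True show ?thesis by simp
  next
    case False
    then obtain j where j: "j \<in> {1..p}" "a j \<noteq> b j"
      using assms PiE_ext unfolding sign_vectors_def by blast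
    have "a j * b j + 1 = 0"
      using PiE_mem [OF assms(1) [unfolded sign_vectors_def] j(1)]
        PiE_mem [OF assms(2) [unfolded sign_vectors_def] j(1)] j(2) by auto
    with j False show ?thesis by (auto intro!: prod_zero)
  qed
  finally show ?thesis .
qed

lemma finite_sign_vectors: "finite (sign_vectors p)"
  unfolding sign_vectors_def by (intro finite_PiE) auto

lemma ex1_coeff_vector:
  fixes f :: "(nat \<Rightarrow> real) \<Rightarrow> real"
  shows "\<exists>!\<beta>. \<beta> \<in> coeff_vectors p \<and> (\<forall>a\<in>sign_vectors p. coeff_inner p \<beta> (tensor_vec p a) = f a)"
proof (rule ex1I)
  define \<beta> where
    "\<beta> = (\<lambda>L\<in>Pow {1..p}. (\<Sum>a\<in>sign_vectors p. f a * tensor_vec p a L) / 2 ^ p)"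
  have "coeff_inner p \<beta> (tensor_vec p b) = f b" if b: "b \<in> sign_vectors p" for b
  proof -
    have "coeff_inner p \<beta> (tensor_vec p b)
        = (\<Sum>L\<in>Pow {1..p}. \<Sum>a\<in>sign_vectors p. f a * (tensor_vec p a L * tensor_vec p b L) / 2 ^ p)"
      by (simp add: coeff_inner_def \<beta>_def sum_divide_distrib sum_distrib_right mult.assoc)
    also have "\<dots> = (\<Sum>a\<in>sign_vectors p.
        f a * (\<Sum>L\<in>Pow {1..p}. tensor_vec p a L * tensor_vec p b L) / 2 ^ p)"
      by (subst sum.swap) (simp add: sum_distrib_left sum_divide_distrib)
    also have "\<dots> = (\<Sum>a\<in>sign_vectors p. if a = b then f a else 0)"
      using b by (intro sum.cong) (auto simp: sum_coeffs simp del: One_nat_def)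
    also have "\<dots> = f b"
      using b finite_sign_vectors by simp
    finally show ?thesis .
  qed
  then show "\<beta> \<in> coeff_vectors p \<and>
      (\<forall>a\<in>sign_vectors p. coeff_inner p \<beta> (tensor_vec p a) = f a)"
    by (auto simp: \<beta>_def coeff_vectors_def)
  have key: "(\<Sum>a\<in>sign_vectors p. f a * tensor_vec p a K) = 2 ^ p * \<delta> K"
    if \<delta>: "\<And>a. a \<in> sign_vectors p \<Longrightarrow> coeff_inner p \<delta> (tensor_vec p a) = f a"
      and K: "K \<in> Pow {1..p}" for \<delta> K
  proof -
    have "(\<Sum>a\<in>sign_vectors p. f a * tensor_vec p a K)
        = (\<Sum>a\<in>sign_vectors p. coeff_inner p \<delta> (tensor_vec p a) * tensor_vec p a K)"
      using \<delta> by simp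
    also have "\<dots> = (\<Sum>L\<in>Pow {1..p}.
        \<delta> L * (\<Sum>a\<in>sign_vectors p. tensor_vec p a L * tensor_vec p a K))"
      unfolding coeff_inner_def sum_distrib_right sum_distrib_left
      by (subst sum.swap) (simp add: mult.assoc)
    also have "\<dots> = (\<Sum>L\<in>Pow {1..p}. if L = K then 2 ^ p * \<delta> L else 0)"
      using K by (intro sum.cong) (auto simp: sum_sign_vectors simp del: One_nat_def)
    also have "\<dots> = 2 ^ p * \<delta> K" using K by simp
    finally show ?thesis .
  qed
  fix \<delta>
  assume "\<delta> \<in> coeff_vectors p \<and>
      (\<forall>a\<in>sign_vectors p. coeff_inner p \<delta> (tensor_vec p a) = f a)"
  then have \<delta>: "\<delta> \<in> coeff_vectors p"
      "\<And>a. a \<in> sign_vectors p \<Longrightarrow> coeff_inner p \<delta> (tensor_vec p a) = f a" by auto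
  show "\<delta> = \<beta>"
  proof (rule PiE_ext)
    show "\<delta> \<in> Pow {1..p} \<rightarrow>\<^sub>E UNIV" using \<delta>(1) by (simp add: coeff_vectors_def)
    show "\<beta> \<in> Pow {1..p} \<rightarrow>\<^sub>E UNIV" by (auto simp: \<beta>_def)
    show "\<delta> K = \<beta> K" if "K \<in> Pow {1..p}" for K
      using key [OF \<delta>(2) that] that by (simp add: \<beta>_def)
  qed
qed

lemma nondegenerate_range:
  assumes "A \<in> M \<rightarrow>\<^sub>M count_space (sign_vectors p)" "nondegenerate p M A"
  shows "A ` space M = sign_vectors p"
proof
  show "A ` space M \<subseteq> sign_vectors p"
    using measurable_space [OF assms(1)] by auto
  show "sign_vectors p \<subseteq> A ` space M"
  proof
    fix a assume "a \<in> sign_vectors p"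
    then have "measure M {\<omega> \<in> space M. A \<omega> = a} \<noteq> 0"
      using assms(2) by (force simp: nondegenerate_def)
    then have "{\<omega> \<in> space M. A \<omega> = a} \<noteq> {}" using measure_empty by metis
    then show "a \<in> A ` space M" by auto
  qed
qed

lemma ex1_beta_vec:
  assumes "A \<in> M \<rightarrow>\<^sub>M count_space (sign_vectors p)" "nondegenerate p M A"
  shows "\<exists>!\<beta>. \<beta> \<in> coeff_vectors p \<and>
    (\<forall>\<omega>\<in>space M. coeff_inner p \<beta> (tensor_vec p (A \<omega>)) =
      the_inv_into {- 1<..<1} g (coeff_inner p \<gamma> (tensor_vec p (A \<omega>))))"
  using ex1_coeff_vector
    [of p "\<lambda>a. the_inv_into {- 1<..<1} g (coeff_inner p \<gamma> (tensor_vec p a))"]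
  unfolding nondegenerate_range [OF assms, symmetric] by simp

end

theory Submission
  imports Defs
begin

text \<open>
  Prescribe the value of \<open>g\<^sup>-\<^sup>1(\<gamma>\<^sup>T A\<^sup>\<otimes>)\<close> to be \<open>x\<close> on \<open>A\<^sub>1 = A\<^sub>2 = 1\<close>, \<open>y\<close> on
  \<open>A\<^sub>1 = A\<^sub>2 = -1\<close> and \<open>(x + y) / 2\<close> on \<open>A\<^sub>1 \<noteq> A\<^sub>2\<close>.  The interaction coefficient of such a
  function is a quarter of the mixed difference of its values, so that of \<open>\<beta>\<close> vanishes; hence that
  of \<open>\<gamma>\<close> vanishes, which is Jensen's equation \<open>g x + g y = 2 g ((x + y) / 2)\<close>.
  Continuous solutions of Jensen's equation are affine.
\<close>

section \<open>Jensen's functional equation\<close>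

text \<open>A maximum principle. Applied to both \<open>h\<close> and \<open>- h\<close>, it forces
  the deviation of a function from its chord to vanish.\<close>

lemma midpoint_affine_imp_nonpos:
  fixes h :: "real \<Rightarrow> real"
  assumes cont: "continuous_on {u..v} h"
    and mid: "\<And>x y. x \<in> {u..v} \<Longrightarrow> y \<in> {u..v} \<Longrightarrow> h x + h y = 2 * h ((x + y) / 2)"
    and ends: "h u = 0" "h v = 0" and x: "x \<in> {u..v}"
  shows "h x \<le> 0"
proof -
  have "{u..v} \<noteq> {}" using x by auto
  then obtain t where t: "t \<in> {u..v}" "\<And>y. y \<in> {u..v} \<Longrightarrow> h y \<le> h t"
    using continuous_attains_sup [OF compact_Icc _ cont] by blast
  define S where "S = {y \<in> {u..v}. h y = h t}"
  have "closed S"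
    unfolding S_def by (intro continuous_closed_preimage_constant cont closed_atLeastAtMost)
  moreover have "bounded S"
    by (rule bounded_subset [of "{u..v}"]) (auto simp: S_def)
  ultimately have "compact S" by (simp add: compact_eq_bounded_closed)
  moreover have "S \<noteq> {}" using t by (auto simp: S_def)
  ultimately obtain s where s: "s \<in> S" "\<And>y. y \<in> S \<Longrightarrow> s \<le> y"
    by (metis compact_attains_inf)
  \<comment> \<open>The leftmost maximum point cannot be interior: its value would be the mean of two values,
    the left one of which is smaller.\<close>
  have "s = u \<or> s = v"
  proof (rule ccontr)
    assume "\<not> ?thesis"
    then have uv: "u < s" "s < v" using s(1) by (auto simp: S_def)
    \<comment> \<open>The largest radius for which both points symmetric about \<open>s\<close> stay
      in the interval.\<close>
    define d where "d = min (s - u) (v - s)"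
    have d: "d > 0" "s - d \<in> {u..v}" "s + d \<in> {u..v}" using uv by (auto simp: d_def min_def)
    have "h (s - d) + h (s + d) = 2 * h t"
      using mid [OF d(2,3)] s(1) by (simp add: S_def)
    then have "h (s - d) = h t" using t(2) [OF d(2)] t(2) [OF d(3)] by linarith
    then have "s - d \<in> S" using d(2) by (simp add: S_def)
    then show False using s(2) d(1) by fastforce
  qed
  then have "h t = 0" using s(1) ends by (auto simp: S_def)
  then show ?thesis using t(2) [OF x] by simp
qed

lemma midpoint_affine_imp_chord:
  fixes f :: "real \<Rightarrow> real"
  assumes cont: "continuous_on {u..v} f"
    and mid: "\<And>x y. x \<in> {u..v} \<Longrightarrow> y \<in> {u..v} \<Longrightarrow> f x + f y = 2 * f ((x + y) / 2)"
    and x: "x \<in> {u..v}"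
  shows "(v - u) * f x = (v - x) * f u + (x - u) * f v"
proof -
  \<comment> \<open>The deviation of \<open>f\<close> from its chord, multiplied by
    \<open>v - u\<close>: without division, the case \<open>u = v\<close> is covered as
    well.\<close>
  define h where "h x = (v - u) * f x - (v - x) * f u - (x - u) * f v" for x
  have h_cont: "continuous_on {u..v} h"
    unfolding h_def by (intro continuous_intros cont)
  have h_mid: "h x + h y = 2 * h ((x + y) / 2)" if "x \<in> {u..v}" "y \<in> {u..v}" for x y
  proof -
    have "h x + h y = (v - u) * (f x + f y) - (2 * v - x - y) * f u - (x + y - 2 * u) * f v"
      by (simp add: h_def algebra_simps)
    also have "\<dots> = 2 * h ((x + y) / 2)"
      unfolding mid [OF that] by (simp add: h_def field_simps)
    finally show ?thesis .
  qed
  have "h x \<le> 0"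
    by (rule midpoint_affine_imp_nonpos [OF h_cont h_mid]) (use x in \<open>simp_all add: h_def\<close>)
  moreover have "- h x \<le> 0"
  proof (rule midpoint_affine_imp_nonpos [where h = "\<lambda>x. - h x"])
    show "continuous_on {u..v} (\<lambda>x. - h x)" by (intro continuous_intros h_cont)
    show "- h x + - h y = 2 * - h ((x + y) / 2)" if "x \<in> {u..v}" "y \<in> {u..v}" for x y
      using h_mid [OF that] by simp
  qed (use x in \<open>simp_all add: h_def\<close>)
  ultimately show ?thesis by (simp add: h_def)
qed

text \<open>Chords are compared on compact subintervals only, so \<open>S\<close> need not be
  closed; this allows the open interval (-1,1). Two fixed points of \<open>S\<close> determine the
  slope.\<close>

lemma midpoint_affine_imp_affine:
  fixes f :: "real \<Rightarrow> real"
  assumes "convex S" and cont: "continuous_on S f"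
    and mid: "\<And>x y. x \<in> S \<Longrightarrow> y \<in> S \<Longrightarrow> f x + f y = 2 * f ((x + y) / 2)"
  shows "\<exists>a b. \<forall>x\<in>S. f x = a * x + b"
proof (cases "\<exists>p\<in>S. \<exists>q\<in>S. p < q")
  case False
  then have "x = y" if "x \<in> S" "y \<in> S" for x y
    using that by (meson linorder_neqE_linordered_idom)
  \<comment> \<open>Here \<open>S\<close> has at most one point, so a constant will do.\<close>
  then have "\<exists>b. \<forall>x\<in>S. f x = 0 * x + b" by (cases "S = {}") force+
  then show ?thesis by blast
next
  case True
  then obtain p q where pq: "p \<in> S" "q \<in> S" "p < q" by blast
  have chord: "(w - u) * f x = (w - x) * f u + (x - u) * f w"
    if "u \<in> S" "w \<in> S" "u \<le> x" "x \<le> w" for u x w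
  proof -
    have "{u..w} \<subseteq> S"
      using \<open>convex S\<close> that(1,2)
      by (meson atLeastAtMost_iff is_interval_convex_1 mem_is_interval_1_I subsetI)
    then show ?thesis
      using that(3,4) by (intro midpoint_affine_imp_chord continuous_on_subset [OF cont] mid) auto
  qed
  define a where "a = (f q - f p) / (q - p)"
  have "f x = a * x + (f p - a * p)" if x: "x \<in> S" for x
  proof -
    \<comment> \<open>In each order, the chord through the outer two of the three points, evaluated
      at the middle one, rearranges to the same identity.\<close>
    consider "x \<le> p" | "p \<le> x" "x \<le> q" | "q \<le> x" by linarith
    then have "(q - p) * (f x - f p) = (f q - f p) * (x - p)"
    proof cases
      case 1
      show ?thesis using chord [of x q p] 1 pq x by (simp add: algebra_simps)
    next
      case 2
      show ?thesis using chord [of p q x] 2 pq x by (simp add: algebra_simps)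
    next
      case 3
      show ?thesis using chord [of p x q] 3 pq x by (simp add: algebra_simps)
    qed
    then have "f x - f p = a * (x - p)" using pq(3) by (simp add: a_def field_simps)
    then show ?thesis by (simp add: algebra_simps)
  qed
  then show ?thesis by blast
qed

section \<open>Functions of the first two signs\<close>

text \<open>The Walsh coefficients of the function of the first two signs with value
  \<open>P\<close> at (1,1), \<open>Q\<close> at (-1,-1) and \<open>R\<close> at the two mixed
  pairs: each is the mean over the four pairs of value times monomial.\<close>

definition pair_vec :: "nat \<Rightarrow> real \<Rightarrow> real \<Rightarrow> real \<Rightarrow> nat set \<Rightarrow> real" where
  "pair_vec p P Q R = (\<lambda>L\<in>Pow {1..p}.
    if L = {} then (P + Q + 2 * R) / 4
    else if L = {1} \<or> L = {2} then (P - Q) / 4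
    else if L = {1, 2} then (P + Q - 2 * R) / 4
    else 0)"

lemma pair_vec_interaction:
  assumes "p \<ge> 2"
  shows "pair_vec p P Q R {1, 2} = (P + Q - 2 * R) / 4"
proof -
  have "{1, 2} \<in> Pow {1..p}" using assms by auto
  moreover have "{1::nat, 2} \<noteq> {}" "{1::nat, 2} \<noteq> {1}" "{1::nat, 2} \<noteq> {2}" by auto
  ultimately show ?thesis by (simp add: pair_vec_def del: One_nat_def)
qed

lemma pair_vec_coeff: "pair_vec p P Q R \<in> coeff_vectors p"
  by (auto simp: pair_vec_def coeff_vectors_def)

lemma coeff_inner_pair_vec:
  assumes "p \<ge> 2" "a \<in> sign_vectors p"
  shows "coeff_inner p (pair_vec p P Q R) (tensor_vec p a) =
    (if a 1 \<noteq> a 2 then R else if a 1 = 1 then P else Q)"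
proof -
  let ?T = "{{}, {1}, {2}, {1, 2}} :: nat set set"
  have T: "?T \<subseteq> Pow {1..p}" using assms(1) by auto
  have ne: "{1::nat, 2} \<noteq> {1}" "{1::nat, 2} \<noteq> {2}" "{2::nat} \<noteq> {1}" by auto
  have "coeff_inner p (pair_vec p P Q R) (tensor_vec p a) =
      (\<Sum>L\<in>?T. pair_vec p P Q R L * tensor_vec p a L)"
    unfolding coeff_inner_def
    by (rule sum.mono_neutral_right) (use T in \<open>auto simp: pair_vec_def\<close>)
  also have "\<dots> = (P + Q + 2 * R) / 4 + (P - Q) / 4 * (a 1 + a 2)
      + (P + Q - 2 * R) / 4 * (a 1 * a 2)"
    using T ne by (simp add: pair_vec_def tensor_vec_def field_simps del: One_nat_def)
  also have "\<dots> = (if a 1 \<noteq> a 2 then R else if a 1 = 1 then P else Q)"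
  proof -
    have "a 1 = - 1 \<or> a 1 = 1" "a 2 = - 1 \<or> a 2 = 1"
      using assms unfolding sign_vectors_def by (auto simp: PiE_iff)
    then show ?thesis by (auto simp: field_simps)
  qed
  finally show ?thesis .
qed

text \<open>Non-degeneracy makes the solution unique, so exhibiting one vector evaluates the
  definite description.\<close>

lemma beta_vec_eqI:
  assumes "A \<in> M \<rightarrow>\<^sub>M count_space (sign_vectors p)" "nondegenerate p M A"
    and "\<beta> \<in> coeff_vectors p"
    and "\<And>\<omega>. \<omega> \<in> space M \<Longrightarrow> coeff_inner p \<beta> (tensor_vec p (A \<omega>)) =
      the_inv_into {- 1<..<1} g (coeff_inner p \<gamma> (tensor_vec p (A \<omega>)))"
  shows "beta_vec g p M A \<gamma> = \<beta>"
  unfolding beta_vec_def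
  by (rule the1_equality [OF ex1_beta_vec [OF assms(1,2)]]) (use assms(3,4) in blast)

theorem theorem4p3:
  fixes g :: "real \<Rightarrow> real" and p :: nat
    and M :: "'a measure" and A :: "'a \<Rightarrow> nat \<Rightarrow> real"
  assumes "continuous_on {- 1<..<1} g"
    and "mono_on {- 1<..<1} g"
    and "inj_on g {- 1<..<1}"
    and "p \<ge> 2"
    and "prob_space M"
    and "A \<in> M \<rightarrow>\<^sub>M count_space (sign_vectors p)"
    and "nondegenerate p M A"
    and "\<And>\<gamma>. admissible g p M A \<gamma> \<Longrightarrow> \<gamma> {1, 2} = 0 \<longleftrightarrow> beta_vec g p M A \<gamma> {1, 2} = 0"
  shows "\<exists>a b. \<forall>x\<in>{- 1<..<1}. g x = a * x + b"
proof (rule midpoint_affine_imp_affine)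
  fix x y :: real
  assume xy: "x \<in> {- 1<..<1}" "y \<in> {- 1<..<1}"
  define z where "z = (x + y) / 2"
  have z: "z \<in> {- 1<..<1}" using xy by (auto simp: z_def)
  define \<gamma> where "\<gamma> = pair_vec p (g x) (g y) (g z)"
  have sign: "A \<omega> \<in> sign_vectors p" if "\<omega> \<in> space M" for \<omega>
    using measurable_space [OF assms(6) that] by simp
  have "admissible g p M A \<gamma>"
    unfolding admissible_def \<gamma>_def
    using xy z sign by (simp add: pair_vec_coeff coeff_inner_pair_vec [OF assms(4)])
  \<comment> \<open>The inverse of \<open>g\<close> acts value by value, turning \<open>g x\<close>,
    \<open>g y\<close>, \<open>g z\<close> back into \<open>x\<close>, \<open>y\<close>,
    \<open>z\<close>.\<close>
  moreover have "beta_vec g p M A \<gamma> = pair_vec p x y z"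
    using xy z
    by (intro beta_vec_eqI [OF assms(6,7)] pair_vec_coeff)
      (simp add: \<gamma>_def coeff_inner_pair_vec [OF assms(4) sign] the_inv_into_f_f [OF assms(3)])
  \<comment> \<open>The coefficient is \<open>(x + y - 2 * z) / 4\<close>, which is zero as
    \<open>z\<close> is the midpoint.\<close>
  then have "beta_vec g p M A \<gamma> {1, 2} = 0"
    by (simp only: pair_vec_interaction [OF assms(4)]) (simp add: z_def)
  ultimately have "\<gamma> {1, 2} = 0" using assms(8) by blast
  then show "g x + g y = 2 * g ((x + y) / 2)"
    by (simp only: \<gamma>_def pair_vec_interaction [OF assms(4)]) (simp add: z_def)
qed (use assms(1) in simp_all)

end
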